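(* Consider an instance of the scheduling problem $1,\mathrm{TOU}\mid \text{states}\mid \mathrm{TEC}$ with job set $\mathcal{J}$. Let $\widehat{\mathcal{J}}\subseteq\mathcal{J}$, let $\widehat{\pi}:\{1,\dots,|\widehat{\mathcal{J}}|\}\to\widehat{\mathcal{J}}$ be a partial job sequence (a bijection), and let $\widehat{\pi}^{\mathrm{lb}}$ and $\widehat{\pi}^{\mathrm{lb}}_{\gcd}$ be the relaxed sequences (defined in the context) in which the jobs of $\widehat{\pi}$ are followed by the remaining total processing time split into jobs of processing time $1$, respectively into jobs of processing time equal to the greatest common divisor of the processing times of the jobs in $\mathcal{J}\setminus\widehat{\mathcal{J}}$. Then for any permutation (bijection) $\pi:\{1,\dots,|\mathcal{J}|\}\to\mathcal{J}$ satisfying $\pi(\ell)=\widehat{\pi}(\ell)$ for all $\ell\in\{1,\dots,|\widehat{\mathcal{J}}|\}$, it holds that $$c^{\mathrm{TEC}}(\pi)\ \ge\ c^{\mathrm{TEC}}(\widehat{\pi}^{\mathrm{lb}}_{\gcd})\ \ge\ c^{\mathrm{TEC}}(\widehat{\pi}^{\mathrm{lb}}).$$ Moreover, the second inequality is strict for some inputs: there exist an instance and a partial sequence $\widehat{\pi}$ with $c^{\mathrm{TEC}}(\widehat{\pi}^{\mathrm{lb}}_{\gcd})> c^{\mathrm{TEC}}(\widehat{\pi}^{\mathrm{lb}})$.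
   Context: Problem $1,\mathrm{TOU}\mid \text{states}\mid\mathrm{TEC}$. The horizon is a set of unit-length intervals $\mathcal{I}=\{1,\dots,h\}$ with energy costs $c_1,\dots,c_h\in\mathbb{Q}$ (possibly negative). A machine has a finite set of states $\mathcal{S}$ containing $\mathtt{off}$ and $\mathtt{proc}$, a transition time function $T:\mathcal{S}\times\mathcal{S}\to\mathbb{Z}_{\ge0}\cup\{\infty\}$ and a transition power function $P:\mathcal{S}\times\mathcal{S}\to\mathbb{Q}_{\ge0}\cup\{\infty\}$; the value $\infty$ means that the direct transition does not exist. A transition from $s$ to $s'$ lasts $T(s,s')$ intervals and consumes power $P(s,s')$ in each of them; $T(s,s)=1$, so $P(s,s)$ is the consumption for staying in $s$ during one interval. Jobs $\mathcal{J}=\{J_1,\dots,J_n\}$ have processing times $p_j\in\mathbb{Z}_{>0}$, are non-preemptive and all available at the start. Solutions. A solution consists of start times of the jobs and a vector $\Omega=(\Omega_1,\dots,\Omega_h)\in(\mathcal{S}\times\mathcal{S})^h$ giving the state (pair $(s,s)$) or transition (pair $(s,s')$) active in each interval. It is feasible if (1) at most one job is processed at a time; (2) jobs are processed only when the machine is in state $\mathtt{proc}$, i.e. a job with processing time $p$ started at the beginning of interval $i$ occupies the intervals $i,\dots,i+p-1$, in each of which $\Omega=(\mathtt{proc},\mathtt{proc})$; (3) the machine is in $\mathtt{off}$ (pair $(\mathtt{off},\mathtt{off})$) in the first and the last interval; (4) $\Omega$ arises from a consecutive sequence of existing transitions, each $(s,s')$ occupying exactly $T(s,s')$ consecutive intervals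 (zero-duration transitions occupy none). Its total energy cost (TEC) is $\sum_{i=1}^h c_i\,P(\Omega_i)$. Fixed sequences. For a sequence $\rho$ of jobs (ordering of some finite set of jobs with given processing times, on the same horizon and machine), $c^{\mathrm{TEC}}(\rho)$ is the minimum TEC over all feasible solutions that schedule exactly these jobs, in the order $\rho$ ($+\infty$ if there are none). Relaxed sequences. Let $R=\sum_{J_{j}\in\mathcal{J}\setminus\widehat{\mathcal{J}}}p_{j}$. - $\mathcal{J}^{\mathrm{lb}}=\widehat{\mathcal{J}}\cup\{J^1_j: j\in\{1,\dots,R\}\}$, where each $J^1_j$ is a new job with unit processing time, and $\widehat{\pi}^{\mathrm{lb}}(\ell)=\widehat{\pi}(\ell)$ for $\ell\le|\widehat{\mathcal{J}}|$, $\widehat{\pi}^{\mathrm{lb}}(\ell)=J^1_{\ell-|\widehat{\mathcal{J}}|}$ for $|\widehat{\mathcal{J}}|<\ell\le|\mathcal{J}^{\mathrm{lb}}|$. - Let $g=\gcd(\{p_{j}: J_{j}\in\mathcal{J}\setminus\widehat{\mathcal{J}}\})$. Then $\mathcal{J}^{\mathrm{lb}}_{\gcd}=\widehat{\mathcal{J}}\cup\{J^{\gcd}_j: j\in\{1,\dots,R/g\}\}$, where each $J^{\gcd}_j$ is a new job with processing time $g$, and $\widehat{\pi}^{\mathrm{lb}}_{\gcd}(\ell)=\widehat{\pi}(\ell)$ for $\ell\le|\widehat{\mathcal{J}}|$, $\widehat{\pi}^{\mathrm{lb}}_{\gcd}(\ell)=J^{\gcd}_{\ell-|\widehat{\mathcal{J}}|}$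 for $|\widehat{\mathcal{J}}|<\ell\le|\mathcal{J}^{\mathrm{lb}}_{\gcd}|$. If $\widehat{\mathcal{J}}=\mathcal{J}$, no new jobs are added and $\widehat{\pi}^{\mathrm{lb}}_{\gcd}=\widehat{\pi}$. *)

theory Defs
  imports "HOL-Library.Extended_Real" "HOL-Library.FuncSet"
begin

text \<open>Horizon, energy costs and machine. The intervals are \<open>{1..horizon}\<close>; values of
  \<open>cost\<close>, \<open>ttime\<close> and \<open>tpower\<close> outside the intervals and the states are irrelevant.\<close>

record 's environment =
  horizon :: nat
  cost :: "nat \<Rightarrow> real"
  states :: "'s set"
  off :: 's
  proc :: 's
  ttime :: "'s \<Rightarrow> 's \<Rightarrow> enat"
  tpower :: "'s \<Rightarrow> 's \<Rightarrow> ereal"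

definition valid_environment :: "'s environment \<Rightarrow> bool" where
  "valid_environment E \<longleftrightarrow>
     1 \<le> horizon E \<and>
     (\<forall>i\<in>{1..horizon E}. cost E i \<in> \<rat>) \<and>
     finite (states E) \<and> off E \<in> states E \<and> proc E \<in> states E \<and> off E \<noteq> proc E \<and>
     (\<forall>s\<in>states E. ttime E s s = 1) \<and>
     (\<forall>s\<in>states E. \<forall>s'\<in>states E.
        tpower E s s' = \<infinity> \<or> (\<exists>x\<in>\<rat>. 0 \<le> x \<and> tpower E s s' = ereal x))"

definition valid_jobs :: "'j set \<Rightarrow> ('j \<Rightarrow> nat) \<Rightarrow> bool" where
  "valid_jobs J p \<longleftrightarrow> finite J \<and> (\<forall>j\<in>J. 0 < p j)"

definition transition_exists :: "'s environment \<Rightarrow> 's \<times> 's \<Rightarrow> bool" where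
  "transition_exists E = (\<lambda>(s, s').
     s \<in> states E \<and> s' \<in> states E \<and> ttime E s s' \<noteq> \<infinity> \<and> tpower E s s' \<noteq> \<infinity>)"

text \<open>The list \<open>ts\<close> is the underlying sequence of direct transitions (staying in \<open>s\<close> for
  one interval being the transition \<open>(s, s)\<close>); those of duration zero appear in \<open>ts\<close> but
  leave no trace in \<open>\<Omega>\<close>.\<close>

definition arises_from_transitions :: "'s environment \<Rightarrow> (nat \<Rightarrow> 's \<times> 's) \<Rightarrow> bool" where
  "arises_from_transitions E \<Omega> \<longleftrightarrow>
     (\<exists>ts. (\<forall>t\<in>set ts. transition_exists E t) \<and>
           (\<forall>k. Suc k < length ts \<longrightarrow> snd (ts ! k) = fst (ts ! Suc k)) \<and>
           map \<Omega> [1..<Suc (horizon E)] =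
             concat (map (\<lambda>(s, s'). replicate (the_enat (ttime E s s')) (s, s')) ts))"

definition occupied :: "('k \<Rightarrow> nat) \<Rightarrow> ('k \<Rightarrow> nat) \<Rightarrow> 'k \<Rightarrow> nat set" where
  "occupied q \<sigma> k = {\<sigma> k..<\<sigma> k + q k}"

definition feasible ::
  "'s environment \<Rightarrow> 'k set \<Rightarrow> ('k \<Rightarrow> nat) \<Rightarrow> ('k \<Rightarrow> nat) \<Rightarrow> (nat \<Rightarrow> 's \<times> 's) \<Rightarrow> bool" where
  "feasible E K q \<sigma> \<Omega> \<longleftrightarrow>
     \<Omega> \<in> {1..horizon E} \<rightarrow> states E \<times> states E \<and>
     (\<forall>k\<in>K. \<forall>l\<in>K. k \<noteq> l \<longrightarrow> occupied q \<sigma> k \<inter> occupied q \<sigma> l = {}) \<and>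
     (\<forall>k\<in>K. occupied q \<sigma> k \<subseteq> {1..horizon E} \<and>
        (\<forall>i\<in>occupied q \<sigma> k. \<Omega> i = (proc E, proc E))) \<and>
     \<Omega> 1 = (off E, off E) \<and> \<Omega> (horizon E) = (off E, off E) \<and>
     arises_from_transitions E \<Omega>"

definition in_order :: "'k set \<Rightarrow> (nat \<Rightarrow> 'k) \<Rightarrow> ('k \<Rightarrow> nat) \<Rightarrow> bool" where
  "in_order K \<rho> \<sigma> \<longleftrightarrow>
     (\<forall>l\<in>{1..card K}. \<forall>m\<in>{1..card K}. l < m \<longrightarrow> \<sigma> (\<rho> l) < \<sigma> (\<rho> m))"

definition tec :: "'s environment \<Rightarrow> (nat \<Rightarrow> 's \<times> 's) \<Rightarrow> ereal" where
  "tec E \<Omega> = (\<Sum>i=1..horizon E. ereal (cost E i) * (case \<Omega> i of (s, s') \<Rightarrow> tpower E s s'))"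

text \<open>The minimum TEC of a fixed sequence \<open>\<rho>\<close> of the jobs in \<open>K\<close> with processing times
  \<open>q\<close>. The infimum is \<open>\<infinity>\<close> if there is no feasible solution and is attained otherwise
  (lemma \<open>c_tec_attained\<close>).\<close>

definition c_tec :: "'s environment \<Rightarrow> 'k set \<Rightarrow> ('k \<Rightarrow> nat) \<Rightarrow> (nat \<Rightarrow> 'k) \<Rightarrow> ereal" where
  "c_tec E K q \<rho> = Inf {tec E \<Omega> | \<sigma> \<Omega>. feasible E K q \<sigma> \<Omega> \<and> in_order K \<rho> \<sigma>}"

lemma c_tec_attained:
  assumes "finite (states E)" and "feasible E K q \<sigma> \<Omega>" and "in_order K \<rho> \<sigma>"
  shows "\<exists>\<sigma>' \<Omega>'. feasible E K q \<sigma>' \<Omega>' \<and> in_order K \<rho> \<sigma>' \<and> tec E \<Omega>' = c_tec E K q \<rho>"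
proof -
  let ?A = "{tec E \<Omega> | \<sigma> \<Omega>. feasible E K q \<sigma> \<Omega> \<and> in_order K \<rho> \<sigma>}"
  let ?F = "{1..horizon E} \<rightarrow>\<^sub>E states E \<times> states E"
  have "?A \<subseteq> tec E ` ?F"
  proof
    fix x assume "x \<in> ?A"
    then obtain \<sigma> \<Omega> where *: "x = tec E \<Omega>" "feasible E K q \<sigma> \<Omega>" by blast
    have "restrict \<Omega> {1..horizon E} \<in> ?F"
      using *(2) by (simp add: feasible_def)
    moreover have "tec E (restrict \<Omega> {1..horizon E}) = x"
      using *(1) by (simp add: tec_def)
    ultimately show "x \<in> tec E ` ?F" by blast
  qed
  moreover have "finite ?F"
    using assms(1) by (intro finite_PiE) auto
  ultimately have fin: "finite ?A"
    by (meson finite_imageI finite_subset)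
  have ne: "?A \<noteq> {}" using assms(2,3) by blast
  have "c_tec E K q \<rho> = Min ?A"
    unfolding c_tec_def by (rule Min_Inf[OF fin ne, symmetric])
  then have "c_tec E K q \<rho> \<in> ?A"
    using Min_in[OF fin ne] by simp
  then show ?thesis
    unfolding mem_Collect_eq by metis
qed

text \<open>Relaxed sequences of a partial sequence \<open>\<pi>h\<close> of \<open>Jh \<subseteq> J\<close>: original jobs are tagged
  with \<open>Inl\<close>, the new job with index \<open>i\<close> is \<open>Inr i\<close>. If \<open>Jh = J\<close> then
  \<open>rest_gcd = rest_time = 0\<close> and \<open>rest_time div rest_gcd = 0\<close>, so there are no new jobs.\<close>

definition rest_time :: "'j set \<Rightarrow> 'j set \<Rightarrow> ('j \<Rightarrow> nat) \<Rightarrow> nat" where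
  "rest_time J Jh p = (\<Sum>j\<in>J - Jh. p j)"

definition rest_gcd :: "'j set \<Rightarrow> 'j set \<Rightarrow> ('j \<Rightarrow> nat) \<Rightarrow> nat" where
  "rest_gcd J Jh p = Gcd (p ` (J - Jh))"

definition relaxed_jobs :: "'j set \<Rightarrow> nat \<Rightarrow> ('j + nat) set" where
  "relaxed_jobs Jh N = Inl ` Jh \<union> Inr ` {1..N}"

definition relaxed_time :: "('j \<Rightarrow> nat) \<Rightarrow> nat \<Rightarrow> 'j + nat \<Rightarrow> nat" where
  "relaxed_time p d = case_sum p (\<lambda>_. d)"

definition relaxed_seq :: "'j set \<Rightarrow> (nat \<Rightarrow> 'j) \<Rightarrow> nat \<Rightarrow> 'j + nat" where
  "relaxed_seq Jh \<pi>h l = (if l \<le> card Jh then Inl (\<pi>h l) else Inr (l - card Jh))"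

definition c_tec_lb ::
  "'s environment \<Rightarrow> 'j set \<Rightarrow> ('j \<Rightarrow> nat) \<Rightarrow> 'j set \<Rightarrow> (nat \<Rightarrow> 'j) \<Rightarrow> ereal" where
  "c_tec_lb E J p Jh \<pi>h =
     c_tec E (relaxed_jobs Jh (rest_time J Jh p)) (relaxed_time p 1) (relaxed_seq Jh \<pi>h)"

definition c_tec_lb_gcd ::
  "'s environment \<Rightarrow> 'j set \<Rightarrow> ('j \<Rightarrow> nat) \<Rightarrow> 'j set \<Rightarrow> (nat \<Rightarrow> 'j) \<Rightarrow> ereal" where
  "c_tec_lb_gcd E J p Jh \<pi>h =
     c_tec E (relaxed_jobs Jh (rest_time J Jh p div rest_gcd J Jh p))
       (relaxed_time p (rest_gcd J Jh p)) (relaxed_seq Jh \<pi>h)"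

definition partial_sequence :: "'j set \<Rightarrow> 'j set \<Rightarrow> (nat \<Rightarrow> 'j) \<Rightarrow> bool" where
  "partial_sequence J Jh \<pi>h \<longleftrightarrow> Jh \<subseteq> J \<and> bij_betw \<pi>h {1..card Jh} Jh"

end

theory Submission
  imports Defs
begin

text \<open>Each relaxation only cuts jobs at the end of the sequence into equal pieces, and this leaves
  the machine untouched. Take any schedule of the sequence that is not yet cut and keep \<open>\<Omega>\<close>. Cut
  the time occupied by each job behind \<open>\<pi>h\<close> into consecutive pieces of length \<open>d\<close>, and give the
  pieces, from left to right, to the new jobs. The machine is in \<open>proc\<close> throughout every piece, and
  all pieces lie behind the jobs of \<open>\<pi>h\<close>, so the result is a schedule of the relaxed sequence with
  the same cost; minimising over a larger set of profiles \<open>\<Omega>\<close> cannot give a larger value.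
  Lemma \<open>c_tec_split_tail\<close> makes this precise. It gives both inequalities: with \<open>d\<close> the gcd, which
  divides every remaining processing time, it cuts the remaining jobs of \<open>\<pi>\<close>, and with \<open>d = 1\<close> it cuts the
  new jobs of the gcd relaxation.

  Strictness comes from unit jobs being able to avoid an expensive interval. With a single job of
  length 2 and a horizon of five intervals, of which only the middle one has positive cost, the
  job has to run through the middle, whereas two unit jobs can be placed one on each side of it
  and the machine switched off in between.\<close>

section \<open>Cutting the end of a sequence into pieces\<close>

text \<open>The starts of all pieces are collected in one set, without their jobs: the cutting then turns
  into a schedule by listing this set in increasing order. The division rounds down, so that every
  piece stays inside its job.\<close>

definition piece_starts :: "'k set \<Rightarrow> ('k \<Rightarrow> nat) \<Rightarrow> ('k \<Rightarrow> nat) \<Rightarrow> nat \<Rightarrow> nat set" where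
  "piece_starts K q \<sigma> d = (\<Union>k\<in>K. (\<lambda>i. \<sigma> k + i * d) ` {..<q k div d})"

lemma piece_within_job:
  assumes "i < q k div d"
  shows "{\<sigma> k + i * d..<\<sigma> k + i * d + d} \<subseteq> occupied q \<sigma> k" and "0 < d"
proof -
  show "0 < d" using assms by (cases d) auto
  have "Suc i * d \<le> (q k div d) * d" using assms by (intro mult_right_mono) auto
  also have "\<dots> \<le> q k" by simp
  finally show "{\<sigma> k + i * d..<\<sigma> k + i * d + d} \<subseteq> occupied q \<sigma> k"
    by (auto simp: occupied_def)
qed

lemma piece_startsE:
  assumes "b \<in> piece_starts K q \<sigma> d"
  obtains k i where "k \<in> K" "i < q k div d" "b = \<sigma> k + i * d"
    "{b..<b + d} \<subseteq> occupied q \<sigma> k"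
  using assms piece_within_job(1)[of _ q _ d \<sigma>] by (auto simp: piece_starts_def)

lemma finite_piece_starts: "finite K \<Longrightarrow> finite (piece_starts K q \<sigma> d)"
  by (simp add: piece_starts_def)

text \<open>No start is counted twice: starts in different jobs differ because the jobs do not overlap.
  Hence there are exactly as many starts as new jobs to be placed.\<close>

lemma card_piece_starts:
  assumes "finite K"
    and disj: "\<And>k l. k \<in> K \<Longrightarrow> l \<in> K \<Longrightarrow> k \<noteq> l \<Longrightarrow> occupied q \<sigma> k \<inter> occupied q \<sigma> l = {}"
  shows "card (piece_starts K q \<sigma> d) = (\<Sum>k\<in>K. q k div d)"
proof -
  have inside: "(\<lambda>i. \<sigma> k + i * d) ` {..<q k div d} \<subseteq> occupied q \<sigma> k" for k
  proof
    fix b assume "b \<in> (\<lambda>i. \<sigma> k + i * d) ` {..<q k div d}"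
    then obtain i where "i < q k div d" "b = \<sigma> k + i * d" by auto
    then show "b \<in> occupied q \<sigma> k"
      using piece_within_job(1)[of i q k d \<sigma>] piece_within_job(2)[of i q k d] by auto
  qed
  have "card (piece_starts K q \<sigma> d) = (\<Sum>k\<in>K. card ((\<lambda>i. \<sigma> k + i * d) ` {..<q k div d}))"
    unfolding piece_starts_def
  proof (rule card_UN_disjoint)
    show "\<forall>k\<in>K. \<forall>l\<in>K. k \<noteq> l \<longrightarrow>
        (\<lambda>i. \<sigma> k + i * d) ` {..<q k div d} \<inter> (\<lambda>i. \<sigma> l + i * d) ` {..<q l div d} = {}"
      using disj inside by blast
  qed (use assms(1) in auto)
  also have "\<dots> = (\<Sum>k\<in>K. q k div d)"
  proof (rule sum.cong)
    fix k
    have "inj_on (\<lambda>i. \<sigma> k + i * d) {..<q k div d}"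
      by (rule inj_onI) (use piece_within_job(2) in fastforce)
    then show "card ((\<lambda>i. \<sigma> k + i * d) ` {..<q k div d}) = q k div d"
      by (simp add: card_image)
  qed simp
  finally show ?thesis .
qed

lemma disjoint_pieces:
  assumes b: "b \<in> piece_starts K q \<sigma> d" and c: "c \<in> piece_starts K q \<sigma> d" and "b \<noteq> c"
    and disj: "\<And>k l. k \<in> K \<Longrightarrow> l \<in> K \<Longrightarrow> k \<noteq> l \<Longrightarrow> occupied q \<sigma> k \<inter> occupied q \<sigma> l = {}"
  shows "{b..<b + d} \<inter> {c..<c + d} = {}"
proof -
  obtain k i where k: "k \<in> K" "b = \<sigma> k + i * d" "{b..<b + d} \<subseteq> occupied q \<sigma> k"
    using b by (rule piece_startsE)
  obtain l j where l: "l \<in> K" "c = \<sigma> l + j * d" "{c..<c + d} \<subseteq> occupied q \<sigma> l"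
    using c by (rule piece_startsE)
  show ?thesis
  proof (cases "k = l")
    case True
    have apart: "i * d + d \<le> j * d" if "i < j" for i j
      using mult_right_mono[of "Suc i" j d] that by simp
    from True k l \<open>b \<noteq> c\<close> have "i < j \<or> j < i" by (metis linorder_neqE_nat)
    then show ?thesis using apart[of i j] apart[of j i] k(2) l(2) True by auto
  next
    case False
    then show ?thesis using disj[of k l] k l by blast
  qed
qed

lemma card_relaxed_jobs: "finite Jh \<Longrightarrow> card (relaxed_jobs Jh N) = card Jh + N"
  unfolding relaxed_jobs_def by (subst card_Un_disjoint) (auto simp: card_image)

text \<open>The cut schedule has the same \<open>\<Omega>\<close>, so every cost that is attainable before cutting is
  attainable afterwards. The embedding \<open>e\<close> allows the uncut sequence to have its own type of jobs:
  it consists of original jobs in one use and of tagged jobs of a relaxed sequence in the other.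
  For \<open>d = 0\<close>, which is the gcd of no jobs at all, division by zero makes \<open>N = 0\<close>, as it should
  be. For a \<open>d\<close> that does not divide a processing time, the machine idles in \<open>proc\<close> during the
  remainder.\<close>

lemma c_tec_split_tail:
  fixes e :: "'j \<Rightarrow> 'k"
  assumes "finite K" and \<rho>: "bij_betw \<rho> {1..card K} K"
    and "inj_on e Jh" and "e ` Jh \<subseteq> K" and \<pi>h: "bij_betw \<pi>h {1..card Jh} Jh"
    and prefix: "\<And>l. l \<in> {1..card Jh} \<Longrightarrow> \<rho> l = e (\<pi>h l)"
    and time: "\<And>j. j \<in> Jh \<Longrightarrow> q (e j) = p j"
    and N: "N = (\<Sum>k\<in>K - e ` Jh. q k div d)"
  shows "c_tec E (relaxed_jobs Jh N) (relaxed_time p d) (relaxed_seq Jh \<pi>h) \<le> c_tec E K q \<rho>"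
  unfolding c_tec_def
proof (rule Inf_superset_mono, safe)
  fix \<sigma> \<Omega> assume feas: "feasible E K q \<sigma> \<Omega>" and ord: "in_order K \<rho> \<sigma>"
  let ?T = "K - e ` Jh"
  define B where "B = piece_starts ?T q \<sigma> d"
  define xs where "xs = sorted_list_of_set B"
  define \<tau> where "\<tau> = case_sum (\<lambda>j. \<sigma> (e j)) (\<lambda>i. xs ! (i - 1))"
  have disj: "occupied q \<sigma> k \<inter> occupied q \<sigma> l = {}" if "k \<in> K" "l \<in> K" "k \<noteq> l" for k l
    using feas that by (auto simp: feasible_def)
  have "finite Jh"
    using \<open>finite K\<close> \<open>inj_on e Jh\<close> \<open>e ` Jh \<subseteq> K\<close> by (metis finite_imageD finite_subset)
  have "finite B"
    unfolding B_def using \<open>finite K\<close> by (simp add: finite_piece_starts)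
  then have set_xs: "set xs = B" and len: "length xs = N"
    using card_piece_starts[of ?T q \<sigma> d] \<open>finite K\<close> disj by (auto simp: xs_def B_def N)
  have increasing: "xs ! i < xs ! j" if "i < j" "j < N" for i j
    using that len sorted_wrt_nth_less[OF strict_sorted_list_of_set[of B]] by (simp add: xs_def)
  have nth_B: "xs ! (i - 1) \<in> B" if "i \<in> {1..N}" for i
    using that len set_xs nth_mem[of "i - 1" xs] by auto
  have occ_Inl: "occupied (relaxed_time p d) \<tau> (Inl j) = occupied q \<sigma> (e j)" if "j \<in> Jh" for j
    using time[OF that] by (simp add: occupied_def \<tau>_def relaxed_time_def)
  have occ_Inr: "occupied (relaxed_time p d) \<tau> (Inr i) = {xs ! (i - 1)..<xs ! (i - 1) + d}" for i
    by (simp add: occupied_def \<tau>_def relaxed_time_def)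
  have within_tail: "\<exists>k\<in>?T. occupied (relaxed_time p d) \<tau> (Inr i) \<subseteq> occupied q \<sigma> k"
    if "i \<in> {1..N}" for i
    using nth_B[OF that] unfolding occ_Inr B_def by (elim piece_startsE) (rule bexI)
  have within: "\<exists>k\<in>K. occupied (relaxed_time p d) \<tau> x \<subseteq> occupied q \<sigma> k"
    if "x \<in> relaxed_jobs Jh N" for x
    using that within_tail occ_Inl \<open>e ` Jh \<subseteq> K\<close> unfolding relaxed_jobs_def by blast
  have disj_mixed: "occupied (relaxed_time p d) \<tau> (Inl j) \<inter>
      occupied (relaxed_time p d) \<tau> (Inr i) = {}" if j: "j \<in> Jh" and i: "i \<in> {1..N}" for i j
  proof -
    obtain k where k: "k \<in> ?T" "occupied (relaxed_time p d) \<tau> (Inr i) \<subseteq> occupied q \<sigma> k"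
      using within_tail[OF i] by blast
    have "occupied q \<sigma> (e j) \<inter> occupied q \<sigma> k = {}"
      using k(1) j \<open>e ` Jh \<subseteq> K\<close> by (intro disj) auto
    then show ?thesis using k(2) occ_Inl[OF j] by blast
  qed
  have disj_relaxed: "occupied (relaxed_time p d) \<tau> x \<inter> occupied (relaxed_time p d) \<tau> y = {}"
    if x: "x \<in> relaxed_jobs Jh N" and y: "y \<in> relaxed_jobs Jh N" and "x \<noteq> y" for x y
  proof (cases x; cases y)
    fix i j assume xy: "x = Inl i" "y = Inl j"
    then have *: "i \<in> Jh" "j \<in> Jh" "i \<noteq> j" using that by (auto simp: relaxed_jobs_def)
    then have "e i \<noteq> e j" using \<open>inj_on e Jh\<close> by (auto dest: inj_onD)
    then show ?thesis using * disj[of "e i" "e j"] \<open>e ` Jh \<subseteq> K\<close> xy occ_Inl by auto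
  next
    fix i j assume "x = Inl i" "y = Inr j"
    then show ?thesis using that disj_mixed[of i j] by (auto simp: relaxed_jobs_def)
  next
    fix i j assume "x = Inr i" "y = Inl j"
    then show ?thesis using that disj_mixed[of j i] by (auto simp: relaxed_jobs_def)
  next
    fix i j assume xy: "x = Inr i" "y = Inr j"
    then have *: "i \<in> {1..N}" "j \<in> {1..N}" "i \<noteq> j" using that by (auto simp: relaxed_jobs_def)
    then have "i - 1 < j - 1 \<and> j - 1 < N \<or> j - 1 < i - 1 \<and> i - 1 < N"
      unfolding atLeastAtMost_iff by linarith
    then have "xs ! (i - 1) \<noteq> xs ! (j - 1)"
      using increasing[of "i - 1" "j - 1"] increasing[of "j - 1" "i - 1"] by auto
    then show ?thesis unfolding xy occ_Inr
      using disjoint_pieces[of _ ?T q \<sigma> d] nth_B[OF *(1)] nth_B[OF *(2)] disj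
      unfolding B_def by (metis Diff_iff)
  qed
  have feas': "feasible E (relaxed_jobs Jh N) (relaxed_time p d) \<tau> \<Omega>"
  proof -
    have in_proc: "occupied (relaxed_time p d) \<tau> x \<subseteq> {1..horizon E} \<and>
        (\<forall>i\<in>occupied (relaxed_time p d) \<tau> x. \<Omega> i = (proc E, proc E))"
      if "x \<in> relaxed_jobs Jh N" for x
      using within[OF that] feas unfolding feasible_def by blast
    show ?thesis
      using feas in_proc disj_relaxed unfolding feasible_def
      by (intro conjI ballI impI) simp_all
  qed
  have card_le: "card Jh \<le> card K"
    using card_mono[OF \<open>finite K\<close> \<open>e ` Jh \<subseteq> K\<close>] card_image[OF \<open>inj_on e Jh\<close>] by simp
  \<comment> \<open>The first \<open>card Jh\<close> positions of \<open>\<rho>\<close> are filled by \<open>e ` Jh\<close>, so a job outside this set has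
    a later position and hence a later start.\<close>
  have before_tail: "\<sigma> (e (\<pi>h l)) < \<sigma> k" if l: "l \<in> {1..card Jh}" and k: "k \<in> ?T" for l k
  proof -
    have "k \<in> \<rho> ` {1..card K}"
      using k \<rho> by (simp add: bij_betw_def)
    then obtain m where m: "m \<in> {1..card K}" "k = \<rho> m" by blast
    have "m \<notin> {1..card Jh}"
      using prefix[of m] bij_betwE[OF \<pi>h] k m(2) by blast
    then have "\<sigma> (\<rho> l) < \<sigma> (\<rho> m)"
      using ord l m card_le unfolding in_order_def by auto
    then show ?thesis using prefix[OF l] m by simp
  qed
  have ord': "in_order (relaxed_jobs Jh N) (relaxed_seq Jh \<pi>h) \<tau>"
    unfolding in_order_def card_relaxed_jobs[OF \<open>finite Jh\<close>]
  proof (intro ballI impI)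
    fix l m assume l: "l \<in> {1..card Jh + N}" and m: "m \<in> {1..card Jh + N}" and "l < m"
    consider (old) "m \<le> card Jh" | (mixed) "l \<le> card Jh" "card Jh < m" | (new) "card Jh < l"
      by linarith
    then show "\<tau> (relaxed_seq Jh \<pi>h l) < \<tau> (relaxed_seq Jh \<pi>h m)"
    proof cases
      case old
      then have "\<sigma> (\<rho> l) < \<sigma> (\<rho> m)"
        using ord l m \<open>l < m\<close> card_le unfolding in_order_def by auto
      then show ?thesis
        using old l m \<open>l < m\<close> prefix[of l] prefix[of m] by (simp add: relaxed_seq_def \<tau>_def)
    next
      case mixed
      have "m - card Jh \<in> {1..N}" using mixed m by auto
      then have "xs ! (m - card Jh - 1) \<in> B" by (rule nth_B)
      then obtain k i where "k \<in> ?T" "xs ! (m - card Jh - 1) = \<sigma> k + i * d"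
        unfolding B_def by (rule piece_startsE)
      then show ?thesis
        using before_tail[of l k] mixed l by (simp add: relaxed_seq_def \<tau>_def)
    next
      case new
      then show ?thesis
        using increasing[of "l - card Jh - 1" "m - card Jh - 1"] m \<open>l < m\<close>
        by (simp add: relaxed_seq_def \<tau>_def)
    qed
  qed
  show "\<exists>\<sigma>' \<Omega>'. tec E \<Omega> = tec E \<Omega>' \<and>
      feasible E (relaxed_jobs Jh N) (relaxed_time p d) \<sigma>' \<Omega>' \<and>
      in_order (relaxed_jobs Jh N) (relaxed_seq Jh \<pi>h) \<sigma>'"
    using feas' ord' by blast
qed

section \<open>The two lower bounds\<close>

lemma rest_gcd_dvd: "j \<in> J - Jh \<Longrightarrow> rest_gcd J Jh p dvd p j"
  by (simp add: rest_gcd_def)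

lemma rest_gcd_dvd_rest_time: "rest_gcd J Jh p dvd rest_time J Jh p"
  unfolding rest_time_def by (rule dvd_sum) (rule rest_gcd_dvd)

lemma rest_time_div_gcd:
  "rest_time J Jh p div rest_gcd J Jh p = (\<Sum>j\<in>J - Jh. p j div rest_gcd J Jh p)"
proof (cases "rest_gcd J Jh p = 0")
  case False
  have "rest_time J Jh p = rest_gcd J Jh p * (\<Sum>j\<in>J - Jh. p j div rest_gcd J Jh p)"
    unfolding rest_time_def sum_distrib_left
    by (rule sum.cong) (simp_all add: rest_gcd_dvd)
  then show ?thesis using False by simp
qed simp

lemma c_tec_lb_gcd_le:
  assumes "finite J" "partial_sequence J Jh \<pi>h" "bij_betw \<pi> {1..card J} J"
    and "\<And>l. l \<in> {1..card Jh} \<Longrightarrow> \<pi> l = \<pi>h l"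
  shows "c_tec_lb_gcd E J p Jh \<pi>h \<le> c_tec E J p \<pi>"
  unfolding c_tec_lb_gcd_def
  using assms
  by (intro c_tec_split_tail[where e = "\<lambda>j. j"])
    (auto simp: partial_sequence_def rest_time_div_gcd)

lemma bij_betw_relaxed_seq:
  assumes "finite Jh" and \<pi>h: "bij_betw \<pi>h {1..card Jh} Jh"
  shows "bij_betw (relaxed_seq Jh \<pi>h) {1..card (relaxed_jobs Jh N)} (relaxed_jobs Jh N)"
proof -
  have old: "bij_betw (relaxed_seq Jh \<pi>h) {1..card Jh} (Inl ` Jh)"
  proof -
    have "bij_betw (Inl \<circ> \<pi>h) {1..card Jh} (Inl ` Jh)"
      using \<pi>h by (rule bij_betw_trans) (simp add: bij_betw_def)
    then show ?thesis
      by (rule bij_betw_cong[THEN iffD1, rotated]) (simp add: relaxed_seq_def)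
  qed
  have new: "bij_betw (relaxed_seq Jh \<pi>h) {card Jh + 1..card Jh + N} (Inr ` {1..N})"
    by (rule bij_betw_byWitness[where f' = "case_sum (\<lambda>_. 0) (\<lambda>i. card Jh + i)"])
      (auto simp: relaxed_seq_def intro!: imageI)
  have "{1..card Jh} \<union> {card Jh + 1..card Jh + N} = {1..card Jh + N}" by auto
  then show ?thesis
    using bij_betw_combine[OF old new] unfolding card_relaxed_jobs[OF assms(1)]
    by (auto simp: relaxed_jobs_def)
qed

lemma c_tec_lb_le_gcd:
  assumes "finite J" "partial_sequence J Jh \<pi>h"
  shows "c_tec_lb E J p Jh \<pi>h \<le> c_tec_lb_gcd E J p Jh \<pi>h"
proof -
  let ?g = "rest_gcd J Jh p" and ?R = "rest_time J Jh p"
  let ?K = "relaxed_jobs Jh (?R div ?g)"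
  have fin: "finite Jh" and \<pi>h: "bij_betw \<pi>h {1..card Jh} Jh"
    using assms finite_subset by (auto simp: partial_sequence_def)
  have "?K - Inl ` Jh = Inr ` {1..?R div ?g}"
    by (auto simp: relaxed_jobs_def)
  then have "(\<Sum>k\<in>?K - Inl ` Jh. relaxed_time p ?g k div 1) = (?R div ?g) * ?g"
    by (simp add: sum.reindex relaxed_time_def)
  also have "\<dots> = ?R" by (simp add: rest_gcd_dvd_rest_time)
  finally have "?R = (\<Sum>k\<in>?K - Inl ` Jh. relaxed_time p ?g k div 1)" ..
  then show ?thesis
    unfolding c_tec_lb_def c_tec_lb_gcd_def
    using fin \<pi>h bij_betw_relaxed_seq[OF fin \<pi>h]
    by (intro c_tec_split_tail[where e = Inl])
      (auto simp: relaxed_jobs_def relaxed_seq_def relaxed_time_def)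
qed

section \<open>An instance with a strict gap\<close>

text \<open>State 0 is \<open>off\<close> and state 1 is \<open>proc\<close>; switching is instantaneous and free, so the only
  cost is that of being in \<open>proc\<close> during the third of the five intervals.\<close>

definition peak_environment :: "nat environment" where
  "peak_environment =
     \<lparr>horizon = 5, cost = (\<lambda>i. if i = 3 then 1 else 0), states = {0, 1}, off = 0, proc = 1,
      ttime = (\<lambda>s s'. if s = s' then 1 else 0),
      tpower = (\<lambda>s s'. if s = 1 \<and> s' = 1 then 1 else 0)\<rparr>"

lemma valid_peak_environment: "valid_environment peak_environment"
  by (auto simp: valid_environment_def peak_environment_def one_ereal_def zero_ereal_def
      intro!: bexI[of _ 0] bexI[of _ 1])

lemma tec_peak_environment:
  "tec peak_environment \<Omega> = (if \<Omega> 3 = (1, 1) then 1 else 0)"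
proof -
  have "{1..5::nat} = {1, 2, 3, 4, 5}" by auto
  then show ?thesis
    by (auto simp: tec_def peak_environment_def split: prod.splits)
qed

text \<open>Since the machine is off in intervals 1 and 5, a job of length 2 starts in interval 2 or 3 and
  covers interval 3 in both cases.\<close>

lemma peak_gcd_bound: "1 \<le> c_tec_lb_gcd peak_environment {0::nat} (\<lambda>_. 2) {} \<pi>h"
  unfolding c_tec_lb_gcd_def c_tec_def
proof (rule Inf_greatest, safe)
  fix \<sigma> and \<Omega> :: "nat \<Rightarrow> nat \<times> nat"
  let ?K = "relaxed_jobs {} (rest_time {0::nat} {} (\<lambda>_. 2) div rest_gcd {0::nat} {} (\<lambda>_. 2))"
  let ?q = "relaxed_time (\<lambda>_::nat. 2) (rest_gcd {0::nat} {} (\<lambda>_. 2))"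
  assume feas: "feasible peak_environment ?K ?q \<sigma> \<Omega>"
  have "Inr 1 \<in> ?K" by (simp add: relaxed_jobs_def rest_time_def rest_gcd_def)
  then have "\<forall>i\<in>occupied ?q \<sigma> (Inr 1). \<Omega> i = (proc peak_environment, proc peak_environment)"
    and "occupied ?q \<sigma> (Inr 1) \<subseteq> {1..horizon peak_environment}"
    using feas unfolding feasible_def by blast+
  moreover have "\<Omega> 1 = (off peak_environment, off peak_environment)"
    and "\<Omega> (horizon peak_environment) = (off peak_environment, off peak_environment)"
    using feas unfolding feasible_def by blast+
  ultimately have run: "\<forall>i\<in>occupied ?q \<sigma> (Inr 1). \<Omega> i = (1, 1)"
    and horizon: "occupied ?q \<sigma> (Inr 1) \<subseteq> {1..5}"
    and ends: "\<Omega> 1 = (0, 0)" "\<Omega> 5 = (0, 0)"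
    by (simp_all add: peak_environment_def)
  define a where "a = \<sigma> (Inr 1)"
  have occ: "occupied ?q \<sigma> (Inr 1) = {a, a + 1}"
    by (auto simp: occupied_def relaxed_time_def rest_gcd_def a_def)
  have "\<Omega> a = (1, 1)" "\<Omega> (a + 1) = (1, 1)"
    using run unfolding occ by simp_all
  with ends have "a \<noteq> 1" "a + 1 \<noteq> 5"
    by (metis one_neq_zero prod.inject)+
  moreover have "1 \<le> a" "a + 1 \<le> 5"
    using horizon unfolding occ by simp_all
  ultimately have "a = 2 \<or> a = 3" by linarith
  then have "3 \<in> occupied ?q \<sigma> (Inr 1)" unfolding occ by auto
  then show "1 \<le> tec peak_environment \<Omega>"
    using run by (simp add: tec_peak_environment)
qed

text \<open>Two unit jobs are run in intervals 2 and 4. The machine is off in the other intervals, and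
  its four switches take no time.\<close>

lemma peak_unit_bound: "c_tec_lb peak_environment {0::nat} (\<lambda>_. 2) {} \<pi>h \<le> 0"
proof -
  define \<Omega> :: "nat \<Rightarrow> nat \<times> nat" where "\<Omega> = (\<lambda>i. if i = 2 \<or> i = 4 then (1, 1) else (0, 0))"
  define \<sigma> :: "nat + nat \<Rightarrow> nat" where "\<sigma> = case_sum (\<lambda>_. 0) (\<lambda>i. 2 * i)"
  let ?K = "relaxed_jobs {} (rest_time {0::nat} {} (\<lambda>_. 2))"
  let ?q = "relaxed_time (\<lambda>_::nat. 2) 1"
  let ?ts = "[(0,0),(0,1),(1,1),(1,0),(0,0),(0,1),(1,1),(1,0),(0,0)] :: (nat \<times> nat) list"
  have K: "?K = {Inr 1, Inr 2}"
    by (auto simp: relaxed_jobs_def rest_time_def)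
  have "arises_from_transitions peak_environment \<Omega>"
    unfolding arises_from_transitions_def
  proof (intro exI[of _ ?ts] conjI allI impI)
    show "\<forall>t\<in>set ?ts. transition_exists peak_environment t"
      by (auto simp: transition_exists_def peak_environment_def one_enat_def zero_enat_def)
    show "snd (?ts ! k) = fst (?ts ! Suc k)" if "Suc k < length ?ts" for k
      using that by (auto simp: less_Suc_eq numeral_eq_Suc)
    show "map \<Omega> [1..<Suc (horizon peak_environment)] =
        concat (map (\<lambda>(s, s'). replicate (the_enat (ttime peak_environment s s')) (s, s')) ?ts)"
      by (simp add: peak_environment_def \<Omega>_def upt_conv_Cons one_enat_def zero_enat_def)
  qed
  then have "feasible peak_environment ?K ?q \<sigma> \<Omega>"
    unfolding K feasible_def
    by (auto simp: peak_environment_def occupied_def relaxed_time_def \<sigma>_def \<Omega>_def)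
  moreover have "in_order ?K (relaxed_seq {} \<pi>h) \<sigma>"
    by (auto simp: in_order_def relaxed_seq_def \<sigma>_def)
  ultimately have "c_tec_lb peak_environment {0::nat} (\<lambda>_. 2) {} \<pi>h \<le> tec peak_environment \<Omega>"
    unfolding c_tec_lb_def c_tec_def by (intro Inf_lower) blast
  then show ?thesis by (simp add: tec_peak_environment \<Omega>_def)
qed

theorem proposition2:
  shows "(\<forall>(E :: 's environment) (J :: 'j set) p Jh \<pi>h \<pi>.
            valid_environment E \<and> valid_jobs J p \<and> partial_sequence J Jh \<pi>h \<and>
            bij_betw \<pi> {1..card J} J \<and> (\<forall>l\<in>{1..card Jh}. \<pi> l = \<pi>h l) \<longrightarrow>
            c_tec E J p \<pi> \<ge> c_tec_lb_gcd E J p Jh \<pi>h \<and>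
            c_tec_lb_gcd E J p Jh \<pi>h \<ge> c_tec_lb E J p Jh \<pi>h)
       \<and> (\<exists>(E :: nat environment) (J :: nat set) p Jh \<pi>h.
            valid_environment E \<and> valid_jobs J p \<and> partial_sequence J Jh \<pi>h \<and>
            c_tec_lb_gcd E J p Jh \<pi>h > c_tec_lb E J p Jh \<pi>h)"
proof (intro conjI allI impI; (elim conjE)?)
  fix E :: "'s environment" and J :: "'j set" and p Jh \<pi>h \<pi>
  assume *: "valid_jobs J p" "partial_sequence J Jh \<pi>h" "bij_betw \<pi> {1..card J} J"
    "\<forall>l\<in>{1..card Jh}. \<pi> l = \<pi>h l"
  then have "finite J" by (simp add: valid_jobs_def)
  with * show "c_tec_lb_gcd E J p Jh \<pi>h \<le> c_tec E J p \<pi>"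
    and "c_tec_lb E J p Jh \<pi>h \<le> c_tec_lb_gcd E J p Jh \<pi>h"
    by (auto intro: c_tec_lb_gcd_le c_tec_lb_le_gcd)
next
  have "c_tec_lb peak_environment {0::nat} (\<lambda>_. 2) {} id \<le> 0"
    by (rule peak_unit_bound)
  also have "(0::ereal) < 1" by simp
  also have "1 \<le> c_tec_lb_gcd peak_environment {0::nat} (\<lambda>_. 2) {} id"
    by (rule peak_gcd_bound)
  finally have "c_tec_lb peak_environment {0::nat} (\<lambda>_. 2) {} id
      < c_tec_lb_gcd peak_environment {0::nat} (\<lambda>_. 2) {} id" .
  moreover have "valid_jobs {0::nat} (\<lambda>_. 2)" "partial_sequence {0::nat} {} id"
    by (auto simp: valid_jobs_def partial_sequence_def)
  ultimately show "\<exists>(E :: nat environment) (J :: nat set) p Jh \<pi>h.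
      valid_environment E \<and> valid_jobs J p \<and> partial_sequence J Jh \<pi>h \<and>
      c_tec_lb_gcd E J p Jh \<pi>h > c_tec_lb E J p Jh \<pi>h"
    using valid_peak_environment by blast
qed

end
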